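(* Let $F=(F_1,\ldots,F_n)$ be a tuple of real polynomials in $x\in\mathbb{R}^n$ and let $X=\{x\in\mathbb{R}^n: g_i(x)\ge 0\ (i\in\mathcal{I}),\ g_i(x)=0\ (i\in\mathcal{E})\}$, where $g=(g_1,\ldots,g_m)$ is a nonsingular tuple of real polynomials. Let $\mathfrak{s}:=|\mathcal{K}\setminus\mathrm{SOL}(X,F)|$, and consider Algorithm A (described in the context) applied to $\mathrm{VI}(X,F)$. (i) If $\mathrm{SOL}(X,F)=\emptyset$ and $\mathfrak{s}<\infty$, then Algorithm A detects the nonexistence of solutions of $\mathrm{VI}(X,F)$ (i.e. terminates in Step 1 by infeasibility) at some iteration $k\le\mathfrak{s}+1$. (ii) If $\mathrm{SOL}(X,F)\ne\emptyset$ and $\mathfrak{s}<\infty$, then Algorithm A finds a solution of $\mathrm{VI}(X,F)$ (i.e. terminates in Step 3 with $u^{(k)}\in\mathrm{SOL}(X,F)$) at some iteration $k\le\mathfrak{s}+1$. (iii) Suppose $\mathfrak{s}=\infty$ and Algorithm A does not terminate within finitely many steps. If $u^*$ is an accumulation point of $\{u^{(k)}\}_{k=1}^\infty$, the gap function $\nu$ is continuous at $u^*$, and $\limsup_{k\to\infty}T^{(k)}$ is bounded (i.e. $\bigcup_{k\ge k_0}T^{(k)}$ is bounded for some $k_0$), then $u^*\in\mathrm{SOL}(X,F)$.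
   Context: Throughout, $X\subseteq\mathbb{R}^n$ is nonempty and closed; $\mathcal{E}$ and $\mathcal{I}$ are disjoint index sets with $\mathcal{E}\cup\mathcal{I}=[m]=\{1,\ldots,m\}$. $\mathrm{VI}(X,F)$ is the problem of finding $x\in X$ such that $(y-x)^TF(x)\ge 0$ for all $y\in X$; its solution set is $\mathrm{SOL}(X,F)$. The gap function is $\nu(x):=\inf_{y\in X}(y-x)^TF(x)$. $[x]_1:=(1,x_1,\ldots,x_n)^T$. A property holds generically if it holds for all points of the space of input data except a set of Lebesgue measure zero. Let $G(x)$ be the $(n+m)\times m$ polynomial matrix whose $i$th column is $\nabla g_i(x)$ stacked on top of $g_i(x)e_i$ ($e_i$ the $i$th standard basis vector of $\mathbb{R}^m$). The tuple $g$ is called nonsingular if $G(x)$ has full column rank for every $x\in\mathbb{C}^n$. Equivalently (known result), there is a matrix $L(x)$ of real polynomials with $L(x)G(x)=I_m$. Fix such an $L(x)$, and let $\hat F(x):=(F(x)^T,0,\ldots,0)^T\in\mathbb{R}[x]^{n+m}$, $\lambda(x)=(\lambda_1(x),\ldots,\lambda_m(x)):=L(x)\hat F(x)$. Then $\mathcal{K}$ is the set of $x\in\mathbb{R}^n$ satisfying $$F(x)=\sum_{i=1}^m\lambda_i(x)\nabla g_i(x),\quad g_i(x)=0\ (i\in\mathcal{E}),\quad \lambda_i(x)\ge0,\ g_i(x)\ge0,\ \lambda_i(x)g_i(x)=0\ (i\in\mathcal{I}).$$ ($\mathcal{K}$ coincides with the set of KKT points of $\mathrm{VI}(X,F)$.)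 Algorithm A (all subproblems are understood to be solved exactly and globally): Step 0. Choose a generic positive definite matrix $\Theta\in\mathbb{R}^{(n+1)\times(n+1)}$. Set $k:=1$ and $V:=\emptyset$. Step 1. Consider the problem: minimize $[x]_1^T\Theta[x]_1$ over $x\in\mathbb{R}^n$ subject to $x\in\mathcal{K}$ and $(v-x)^TF(x)\ge0$ for all $v\in V$. If it is infeasible, conclude $\mathrm{SOL}(X,F)=\emptyset$ and stop; otherwise, let $u^{(k)}$ be a minimizer. Step 2. With $u:=u^{(k)}$, let $\varepsilon:=\min_{y\in X}(y-u)^TF(u)$ and compute a nonempty set $T^{(k)}$ of minimizers of this problem. Step 3. If $\varepsilon=0$, then $u^{(k)}\in\mathrm{SOL}(X,F)$ and stop; otherwise set $V:=V\cup T^{(k)}$, $k:=k+1$, and go back to Step 1. Standing assumption: the minimization problem in Step 2 has a minimizer for every $u^{(k)}$ that is produced. *)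

theory Defs
  imports "HOL-Analysis.Analysis" "HOL-Library.Poly_Mapping"
begin

section \<open>Real polynomials in the variables \<open>x\<^sub>j\<close>, \<open>j :: 'n\<close>\<close>

text \<open>A polynomial maps each exponent vector to its coefficient; the ring structure is the
  convolution structure of \<^theory>\<open>HOL-Library.Poly_Mapping\<close>.\<close>

type_synonym 'n mpoly = "('n \<Rightarrow>\<^sub>0 nat) \<Rightarrow>\<^sub>0 real"

definition peval :: "'n::finite mpoly \<Rightarrow> 'a::real_field ^ 'n \<Rightarrow> 'a" where
  "peval p x = (\<Sum>\<alpha>\<in>Poly_Mapping.keys p.
     of_real (Poly_Mapping.lookup p \<alpha>) * (\<Prod>j\<in>UNIV. (x $ j) ^ Poly_Mapping.lookup \<alpha> j))"

text \<open>Formal partial derivative. If \<open>x\<^sub>j\<close> does not occur in a monomial, the subtraction in the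
  exponent truncates, but the coefficient is then \<open>0\<close>.\<close>

definition mpderiv :: "'n::finite \<Rightarrow> 'n mpoly \<Rightarrow> 'n mpoly" where
  "mpderiv j p = (\<Sum>\<alpha>\<in>Poly_Mapping.keys p.
     Poly_Mapping.single (\<alpha> - Poly_Mapping.single j 1)
       (of_nat (Poly_Mapping.lookup \<alpha> j) * Poly_Mapping.lookup p \<alpha>))"

definition peval_vec :: "'n::finite mpoly ^ 'k \<Rightarrow> 'a::real_field ^ 'n \<Rightarrow> 'a ^ 'k" where
  "peval_vec P x = (\<chi> i. peval (P $ i) x)"

definition peval_mat :: "'n::finite mpoly ^ 'c ^ 'r \<Rightarrow> 'a::real_field ^ 'n \<Rightarrow> 'a ^ 'c ^ 'r" where
  "peval_mat A x = (\<chi> i j. peval (A $ i $ j) x)"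

definition mgrad :: "'n::finite mpoly \<Rightarrow> 'n mpoly ^ 'n" where
  "mgrad p = (\<chi> j. mpderiv j p)"


section \<open>Variational inequalities\<close>

definition SOL :: "(real ^ 'n) set \<Rightarrow> (real ^ 'n \<Rightarrow> real ^ 'n) \<Rightarrow> (real ^ 'n) set" where
  "SOL X F = {x \<in> X. \<forall>y\<in>X. (y - x) \<bullet> F x \<ge> 0}"

text \<open>The infimum may be \<open>-\<infinity>\<close>, so the gap function takes extended real values.\<close>

definition gap :: "(real ^ 'n) set \<Rightarrow> (real ^ 'n \<Rightarrow> real ^ 'n) \<Rightarrow> real ^ 'n \<Rightarrow> ereal" where
  "gap X F x = (INF y\<in>X. ereal ((y - x) \<bullet> F x))"

definition constraint_set :: "'m set \<Rightarrow> 'm set \<Rightarrow> 'n::finite mpoly ^ 'm \<Rightarrow> (real ^ 'n) set" where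
  "constraint_set \<E> \<I> g = {x. (\<forall>i\<in>\<I>. peval (g $ i) x \<ge> 0) \<and> (\<forall>i\<in>\<E>. peval (g $ i) x = 0)}"


section \<open>Nonsingular tuples and Lagrange multiplier expressions\<close>

text \<open>The \<open>(n+m) \<times> m\<close> matrix \<open>G\<close>; rows \<open>Inl j\<close> form the upper block of gradients, rows \<open>Inr k\<close> the
  lower diagonal block.\<close>

definition G_mat :: "'n::finite mpoly ^ 'm \<Rightarrow> 'n mpoly ^ 'm ^ ('n + 'm)" where
  "G_mat g = (\<chi> r i. case r of Inl j \<Rightarrow> mgrad (g $ i) $ j | Inr k \<Rightarrow> (if k = i then g $ i else 0))"

definition nonsingular_tuple :: "'n::finite mpoly ^ 'm \<Rightarrow> bool" where
  "nonsingular_tuple g \<longleftrightarrow> (\<forall>x :: complex ^ 'n. rank (peval_mat (G_mat g) x) = CARD('m))"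

definition F_hat :: "'n::finite mpoly ^ 'n \<Rightarrow> 'n mpoly ^ ('n + 'm::finite)" where
  "F_hat F = (\<chi> r. case r of Inl j \<Rightarrow> F $ j | Inr k \<Rightarrow> 0)"

definition multipliers ::
    "'n::finite mpoly ^ ('n + 'm::finite) ^ 'm \<Rightarrow> 'n mpoly ^ 'n \<Rightarrow> 'n mpoly ^ 'm" where
  "multipliers L F = L *v F_hat F"

definition KKT_set :: "'m::finite set \<Rightarrow> 'm set \<Rightarrow> 'n::finite mpoly ^ 'm
    \<Rightarrow> 'n mpoly ^ ('n + 'm) ^ 'm \<Rightarrow> 'n mpoly ^ 'n \<Rightarrow> (real ^ 'n) set" where
  "KKT_set \<E> \<I> g L F = {x.
     peval_vec F x = (\<Sum>i\<in>UNIV. peval (multipliers L F $ i) x *\<^sub>R peval_vec (mgrad (g $ i)) x) \<and>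
     (\<forall>i\<in>\<E>. peval (g $ i) x = 0) \<and>
     (\<forall>i\<in>\<I>. peval (multipliers L F $ i) x \<ge> 0 \<and> peval (g $ i) x \<ge> 0 \<and>
             peval (multipliers L F $ i) x * peval (g $ i) x = 0)}"


section \<open>Generic positive definite matrices\<close>

definition pos_def :: "real ^ 'k ^ 'k \<Rightarrow> bool" where
  "pos_def A \<longleftrightarrow> transpose A = A \<and> (\<forall>z. z \<noteq> 0 \<longrightarrow> z \<bullet> (A *v z) > 0)"

definition sym_part :: "real ^ 'k ^ 'k \<Rightarrow> real ^ 'k ^ 'k" where
  "sym_part A = (1 / 2) *\<^sub>R (A + transpose A)"

text \<open>Symmetric matrices form a null set in the space of all matrices, so exceptional sets have to
  be measured within the space of symmetric matrices. Since \<^const>\<open>sym_part\<close> is the orthogonal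
  projection onto that space, a set of symmetric matrices is null there iff its preimage under
  \<^const>\<open>sym_part\<close> is null in the space of all matrices (Fubini).\<close>

definition generic_pos_def :: "(real ^ 'k ^ 'k \<Rightarrow> bool) \<Rightarrow> bool" where
  "generic_pos_def P \<longleftrightarrow> (AE A in lebesgue. pos_def (sym_part A) \<longrightarrow> P (sym_part A))"

text \<open>The vector \<open>[x]\<^sub>1 = (1, x\<^sub>1, \<dots>, x\<^sub>n)\<close>; its leading entry has index \<^const>\<open>None\<close>.\<close>

definition hom1 :: "real ^ 'n \<Rightarrow> real ^ ('n option)" where
  "hom1 x = (\<chi> i. case i of None \<Rightarrow> 1 | Some j \<Rightarrow> x $ j)"


section \<open>The algorithm\<close>

text \<open>A state records the step that is to be executed next, the iteration counter \<open>k\<close>, the current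
  set \<open>V\<close>, and the data \<open>u = u\<^bsup>(k)\<^esup>\<close>, \<open>\<epsilon>\<close>, \<open>T = T\<^bsup>(k)\<^esup>\<close> computed so far in iteration \<open>k\<close>.\<close>

datatype 'a alg_state =
    Step1 nat "'a set"
  | Step2 nat "'a set" 'a
  | Step3 nat "'a set" 'a real "'a set"
  | No_Solution nat
  | Solution nat 'a

definition step1_feasible ::
    "(real ^ 'n) set \<Rightarrow> (real ^ 'n \<Rightarrow> real ^ 'n) \<Rightarrow> (real ^ 'n) set \<Rightarrow> (real ^ 'n) set" where
  "step1_feasible K F V = {x \<in> K. \<forall>v\<in>V. (v - x) \<bullet> F x \<ge> 0}"

definition step2_minimizer ::
    "(real ^ 'n) set \<Rightarrow> (real ^ 'n \<Rightarrow> real ^ 'n) \<Rightarrow> real ^ 'n \<Rightarrow> real ^ 'n \<Rightarrow> bool" where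
  "step2_minimizer X F u = is_arg_min (\<lambda>y. (y - u) \<bullet> F u) (\<lambda>y. y \<in> X)"

text \<open>The choices of the minimizer \<open>u\<close> in Step 1 and of the nonempty set \<open>T\<close> of minimizers in
  Step 2 are nondeterministic.\<close>

inductive alg_step :: "real ^ ('n option) ^ ('n option) \<Rightarrow> (real ^ 'n) set \<Rightarrow> (real ^ 'n) set
    \<Rightarrow> (real ^ 'n \<Rightarrow> real ^ 'n) \<Rightarrow> (real ^ 'n) alg_state \<Rightarrow> (real ^ 'n) alg_state \<Rightarrow> bool"
  for \<Theta> K X F where
  infeasible: "step1_feasible K F V = {}
    \<Longrightarrow> alg_step \<Theta> K X F (Step1 k V) (No_Solution k)"
| minimize: "is_arg_min (\<lambda>x. hom1 x \<bullet> (\<Theta> *v hom1 x)) (\<lambda>x. x \<in> step1_feasible K F V) u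
    \<Longrightarrow> alg_step \<Theta> K X F (Step1 k V) (Step2 k V u)"
| check: "T \<noteq> {} \<Longrightarrow> (\<forall>y\<in>T. step2_minimizer X F u y \<and> \<epsilon> = (y - u) \<bullet> F u)
    \<Longrightarrow> alg_step \<Theta> K X F (Step2 k V u) (Step3 k V u \<epsilon> T)"
| accept: "\<epsilon> = 0 \<Longrightarrow> alg_step \<Theta> K X F (Step3 k V u \<epsilon> T) (Solution k u)"
| refine: "\<epsilon> \<noteq> 0 \<Longrightarrow> alg_step \<Theta> K X F (Step3 k V u \<epsilon> T) (Step1 (k + 1) (V \<union> T))"

text \<open>Maximal executions. If no step is possible, the execution stays in its last state forever;
  besides at \<^const>\<open>No_Solution\<close> and \<^const>\<open>Solution\<close>, this happens when a subproblem of Step 1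
  or Step 2 has no minimizer, and such an execution counts neither as having detected
  nonexistence nor as having found a solution.\<close>

definition alg_run :: "real ^ ('n option) ^ ('n option) \<Rightarrow> (real ^ 'n) set \<Rightarrow> (real ^ 'n) set
    \<Rightarrow> (real ^ 'n \<Rightarrow> real ^ 'n) \<Rightarrow> (nat \<Rightarrow> (real ^ 'n) alg_state) \<Rightarrow> bool" where
  "alg_run \<Theta> K X F \<sigma> \<longleftrightarrow> \<sigma> 0 = Step1 1 {} \<and>
     (\<forall>i. alg_step \<Theta> K X F (\<sigma> i) (\<sigma> (Suc i)) \<or>
          (\<nexists>s. alg_step \<Theta> K X F (\<sigma> i) s) \<and> \<sigma> (Suc i) = \<sigma> i)"

definition step2_solvable ::
    "(real ^ 'n) set \<Rightarrow> (real ^ 'n \<Rightarrow> real ^ 'n) \<Rightarrow> (nat \<Rightarrow> (real ^ 'n) alg_state) \<Rightarrow> bool" where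
  "step2_solvable X F \<sigma> \<longleftrightarrow> (\<forall>i k V u. \<sigma> i = Step2 k V u \<longrightarrow> (\<exists>y. step2_minimizer X F u y))"

definition terminates :: "(nat \<Rightarrow> 'a alg_state) \<Rightarrow> bool" where
  "terminates \<sigma> \<longleftrightarrow> (\<exists>i k. \<sigma> i = No_Solution k \<or> (\<exists>u. \<sigma> i = Solution k u))"

text \<open>Iterations are counted from \<open>1\<close>; \<open>u 0\<close> and \<open>T 0\<close> are irrelevant.\<close>

definition iterates ::
    "(nat \<Rightarrow> 'a alg_state) \<Rightarrow> (nat \<Rightarrow> 'a) \<Rightarrow> (nat \<Rightarrow> 'a set) \<Rightarrow> bool" where
  "iterates \<sigma> u T \<longleftrightarrow> (\<forall>k\<ge>1. \<exists>i V \<epsilon>. \<sigma> i = Step3 k V (u k) \<epsilon> (T k))"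

definition accumulation_point :: "(nat \<Rightarrow> 'a::topological_space) \<Rightarrow> 'a \<Rightarrow> bool" where
  "accumulation_point u l \<longleftrightarrow> (\<exists>r. strict_mono r \<and> (u \<circ> r) \<longlonglongrightarrow> l)"

end

theory Submission
  imports Defs
begin

text \<open>
  The algorithm works because \<open>K\<close> lies between \<open>SOL X f\<close> and \<open>X\<close>, and because each iteration cuts off
  its own iterate unless that iterate is a solution.

  The inclusion \<open>SOL X f \<subseteq> K\<close> is the KKT theorem with the multipliers given as polynomials in \<open>x\<close>
  (\<open>SOL_subset_KKT_set\<close>). The identity \<open>L(x) G(x) = I\<close> says that the rows of \<open>L(x)\<close>, truncated to
  their first \<open>n\<close> entries, are dual to the gradients of the active constraints. This dual system
  serves twice: it makes every direction admissible for the linearized constraints tangent to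
  feasible points (\<open>feasible_displacement\<close>, by Brouwer's fixed-point theorem), and it gives the
  multipliers explicitly, as the inner products of its members with \<open>F(x)\<close>, which are the \<open>\<lambda>\<^sub>i(x)\<close>.

  Solutions satisfy all cuts \<open>(v - x) \<bullet> f x \<ge> 0\<close> with \<open>v \<in> X\<close>, so they are never lost. An iterate \<open>u\<close>
  with \<open>\<epsilon> \<noteq> 0\<close> has \<open>\<epsilon> < 0\<close>; it is then a point of \<open>K - SOL X f\<close> that violates the new cuts. After
  \<open>k\<close> unsuccessful iterations at least \<open>k\<close> points of \<open>K - SOL X f\<close> are excluded
  (\<open>counter_bounded_refine\<close>), which bounds the number of iterations when that set is finite. A run
  cannot get stuck before: a positive definite \<open>\<Theta>\<close> makes the objective of Step 1 coercive on a closed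
  set (\<open>step1_minimizer_exists\<close>).

  In an infinite run every iterate satisfies all earlier cuts. Passing to the limit along the later
  iterates, and using that the cutting points are bounded and realize the gap function at the earlier
  iterates, shows that the gap function is nonnegative at an accumulation point where it is continuous
  (\<open>limit_of_cut_sequence_in_SOL\<close>).
\<close>

section \<open>Evaluation as a ring homomorphism\<close>

definition monomial_value :: "'a::real_field ^ 'n::finite \<Rightarrow> ('n \<Rightarrow>\<^sub>0 nat) \<Rightarrow> 'a" where
  "monomial_value x \<alpha> = (\<Prod>j\<in>UNIV. (x $ j) ^ Poly_Mapping.lookup \<alpha> j)"

lemma monomial_value_0 [simp]: "monomial_value x 0 = 1"
  by (simp add: monomial_value_def)

lemma monomial_value_add: "monomial_value x (\<alpha> + \<beta>) = monomial_value x \<alpha> * monomial_value x \<beta>"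
  by (simp add: monomial_value_def lookup_add power_add prod.distrib)

lemma peval_eq_sum_superset:
  assumes "finite S" "Poly_Mapping.keys p \<subseteq> S"
  shows "peval p x = (\<Sum>\<alpha>\<in>S. of_real (Poly_Mapping.lookup p \<alpha>) * monomial_value x \<alpha>)"
  unfolding peval_def monomial_value_def
  by (rule sum.mono_neutral_left) (use assms in \<open>auto simp: in_keys_iff\<close>)

lemma peval_0 [simp]: "peval 0 x = 0"
  by (simp add: peval_def)

lemma peval_single [simp]: "peval (Poly_Mapping.single \<alpha> c) x = of_real c * monomial_value x \<alpha>"
  by (subst peval_eq_sum_superset[of "{\<alpha>}"]) auto

lemma peval_1 [simp]: "peval 1 x = 1"
  using peval_single[of 0 1 x] by simp

lemma peval_add: "peval (p + q) x = peval p x + peval q x"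
proof -
  let ?S = "Poly_Mapping.keys p \<union> Poly_Mapping.keys q"
  have "Poly_Mapping.keys (p + q) \<subseteq> ?S" by (rule Poly_Mapping.keys_add)
  then show ?thesis
    by (simp add: peval_eq_sum_superset[of ?S] lookup_add algebra_simps sum.distrib)
qed

lemma peval_sum: "peval (sum p S) x = (\<Sum>i\<in>S. peval (p i) x)"
  by (induction S rule: infinite_finite_induct) (auto simp: peval_add)

lemma poly_mapping_eq_sum_single:
  "p = (\<Sum>\<alpha>\<in>Poly_Mapping.keys p. Poly_Mapping.single \<alpha> (Poly_Mapping.lookup p \<alpha>))"
  by (rule poly_mapping_eqI)
     (auto simp: lookup_sum lookup_single when_def in_keys_iff)

lemma peval_mult: "peval (p * q) x = peval p x * peval q x"
proof -
  have "p * q = (\<Sum>\<alpha>\<in>Poly_Mapping.keys p. \<Sum>\<beta>\<in>Poly_Mapping.keys q.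
      Poly_Mapping.single (\<alpha> + \<beta>) (Poly_Mapping.lookup p \<alpha> * Poly_Mapping.lookup q \<beta>))"
    by (subst poly_mapping_eq_sum_single[of p], subst poly_mapping_eq_sum_single[of q])
       (simp add: sum_product mult_single)
  then have "peval (p * q) x = (\<Sum>\<alpha>\<in>Poly_Mapping.keys p. \<Sum>\<beta>\<in>Poly_Mapping.keys q.
      (of_real (Poly_Mapping.lookup p \<alpha>) * monomial_value x \<alpha>) *
      (of_real (Poly_Mapping.lookup q \<beta>) * monomial_value x \<beta>))"
    by (simp add: peval_sum monomial_value_add mult_ac)
  also have "\<dots> = peval p x * peval q x"
    by (simp add: peval_eq_sum_superset[OF finite_keys subset_refl] sum_product)
  finally show ?thesis .
qed


section \<open>Differentiation of polynomial functions\<close>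

lemma has_derivative_monomial_value:
  fixes x :: "real ^ 'n::finite"
  shows "((\<lambda>x. monomial_value x \<alpha>) has_derivative
    (\<lambda>h. \<Sum>j\<in>UNIV. h $ j *
      (real (Poly_Mapping.lookup \<alpha> j) * monomial_value x (\<alpha> - Poly_Mapping.single j 1)))) (at x)"
proof -
  have split: "monomial_value x (\<alpha> - Poly_Mapping.single j 1) =
      x $ j ^ (Poly_Mapping.lookup \<alpha> j - 1) *
      (\<Prod>k\<in>UNIV - {j}. x $ k ^ Poly_Mapping.lookup \<alpha> k)" for j
    unfolding monomial_value_def
    by (subst prod.remove[of UNIV j]) (auto simp: lookup_minus lookup_single intro!: prod.cong)
  have "((\<lambda>x::real^'n. \<Prod>j\<in>UNIV. (x $ j) ^ Poly_Mapping.lookup \<alpha> j) has_derivative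
     (\<lambda>h. \<Sum>j\<in>UNIV. (of_nat (Poly_Mapping.lookup \<alpha> j) * h $ j *
        x $ j ^ (Poly_Mapping.lookup \<alpha> j - 1)) *
        (\<Prod>k\<in>UNIV - {j}. x $ k ^ Poly_Mapping.lookup \<alpha> k))) (at x)"
    by (intro has_derivative_prod has_derivative_power
        bounded_linear.has_derivative[OF bounded_linear_vec_nth] has_derivative_ident)
  moreover have "(\<lambda>x. \<Prod>j\<in>UNIV. (x $ j) ^ Poly_Mapping.lookup \<alpha> j) = (\<lambda>x::real^'n. monomial_value x \<alpha>)"
    by (simp add: monomial_value_def)
  ultimately show ?thesis
    by (auto simp: split[unfolded One_nat_def] mult_ac elim!: has_derivative_eq_rhs)
qed

lemma has_derivative_peval:
  fixes x :: "real ^ 'n::finite"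
  shows "(peval p has_derivative (\<lambda>h. h \<bullet> peval_vec (mgrad p) x)) (at x)"
proof -
  have "((\<lambda>x. \<Sum>\<alpha>\<in>Poly_Mapping.keys p. Poly_Mapping.lookup p \<alpha> * monomial_value x \<alpha>)
     has_derivative (\<lambda>h. \<Sum>\<alpha>\<in>Poly_Mapping.keys p. Poly_Mapping.lookup p \<alpha> *
       (\<Sum>j\<in>UNIV. h $ j * (real (Poly_Mapping.lookup \<alpha> j) *
          monomial_value x (\<alpha> - Poly_Mapping.single j 1))))) (at x)"
    by (intro has_derivative_sum has_derivative_mult_right has_derivative_monomial_value)
  moreover have "peval p = (\<lambda>x. \<Sum>\<alpha>\<in>Poly_Mapping.keys p.
      Poly_Mapping.lookup p \<alpha> * monomial_value x \<alpha>)"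
    by (simp add: peval_eq_sum_superset[OF finite_keys subset_refl] fun_eq_iff)
  moreover have "(\<Sum>\<alpha>\<in>Poly_Mapping.keys p. Poly_Mapping.lookup p \<alpha> *
       (\<Sum>j\<in>UNIV. h $ j * (real (Poly_Mapping.lookup \<alpha> j) *
          monomial_value x (\<alpha> - Poly_Mapping.single j 1)))) = h \<bullet> peval_vec (mgrad p) x" for h
    by (simp add: inner_vec_def peval_vec_def mgrad_def mpderiv_def peval_sum sum_distrib_left mult_ac)
       (rule sum.swap)
  ultimately show ?thesis by simp
qed

lemma continuous_on_peval: "continuous_on S (peval p :: real ^ 'n::finite \<Rightarrow> real)"
  by (meson has_derivative_peval has_derivative_continuous continuous_at_imp_continuous_on)

lemma continuous_on_peval_vec:
  "continuous_on S (peval_vec P :: real ^ 'n::finite \<Rightarrow> real ^ 'k::finite)"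
  unfolding peval_vec_def[abs_def] by (intro continuous_intros continuous_on_peval)


section \<open>Optimality conditions for a linear objective\<close>

text \<open>A constraint qualification in quantitative form. If a dual system \<open>l\<close> is available for the
  gradients of the active constraints, then any direction \<open>d\<close> can be corrected by an arbitrarily
  small fraction of the step length so that each active constraint takes exactly the value that its
  linearization predicts. The correction is sought in the span of the \<open>l j\<close>: with
  \<open>z = (\<Sum>j. w j *\<^sub>R l j)\<close> the linear part of the equation for the \<open>i\<close>th constraint is just \<open>w i\<close>, so the
  equations become a fixed-point problem for a small remainder, to which Brouwer's theorem applies.
  The fixed point lies in a ball of radius proportional to \<open>t\<close>, which is the bound on \<open>z\<close>.\<close>

lemma feasible_displacement:
  fixes G :: "'m::finite \<Rightarrow> 'a::euclidean_space \<Rightarrow> real"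
  assumes deriv: "\<And>i. i \<in> A \<Longrightarrow> (G i has_derivative (\<lambda>h. h \<bullet> grad i)) (at x)"
    and cont: "\<And>i. i \<in> A \<Longrightarrow> continuous_on UNIV (G i)"
    and zero: "\<And>i. i \<in> A \<Longrightarrow> G i x = 0"
    and dual: "\<And>i j. i \<in> A \<Longrightarrow> l j \<bullet> grad i = (if i = j then 1 else 0)"
    and e: "e > 0"
  obtains \<tau> where "\<tau> > 0"
    "\<And>t. 0 < t \<Longrightarrow> t < \<tau> \<Longrightarrow>
       \<exists>z. norm z \<le> e * t \<and> (\<forall>i\<in>A. G i (x + (t *\<^sub>R d + z)) = t * (d \<bullet> grad i))"
proof -
  define C where "C = (\<Sum>j\<in>A. norm (l j))"
  \<comment> \<open>\<open>\<rho> * t\<close> is the radius of the ball of coefficient vectors \<open>w\<close>, \<open>M * t\<close> bounds the resulting step,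
    and \<open>\<eta>\<close> is the relative linearization error for which that ball is mapped into itself.\<close>
  define \<rho> where "\<rho> = e / (C + 1)"
  define M where "M = norm d + e"
  define \<eta> where "\<eta> = \<rho> / (real CARD('m) * M)"
  have C: "C \<ge> 0" by (simp add: C_def sum_nonneg)
  have \<rho>: "\<rho> > 0" and C\<rho>: "C * \<rho> \<le> e" using C e by (auto simp: \<rho>_def field_simps)
  have M: "M > 0" using e by (simp add: M_def add_nonneg_pos)
  have \<eta>: "\<eta> > 0" "real CARD('m) * (\<eta> * M) = \<rho>" using \<rho> M by (auto simp: \<eta>_def)
  have "\<exists>\<delta>>0. \<forall>h. norm h < \<delta> \<longrightarrow> \<bar>G i (x + h) - h \<bullet> grad i\<bar> \<le> \<eta> * norm h" if "i \<in> A" for i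
  proof -
    obtain \<delta> where \<delta>: "\<delta> > 0" "\<And>y. norm (y - x) < \<delta> \<Longrightarrow>
        norm (G i y - G i x - (y - x) \<bullet> grad i) \<le> \<eta> * norm (y - x)"
      using deriv[OF \<open>i \<in> A\<close>] \<eta>(1) unfolding has_derivative_at_alt by blast
    have "\<bar>G i (x + h) - h \<bullet> grad i\<bar> \<le> \<eta> * norm h" if "norm h < \<delta>" for h
      using \<delta>(2)[of "x + h"] that zero[OF \<open>i \<in> A\<close>] by simp
    with \<delta>(1) show ?thesis by blast
  qed
  then obtain \<delta>' where \<delta>': "\<And>i. i \<in> A \<Longrightarrow> \<delta>' i > 0"
      "\<And>i h. i \<in> A \<Longrightarrow> norm h < \<delta>' i \<Longrightarrow> \<bar>G i (x + h) - h \<bullet> grad i\<bar> \<le> \<eta> * norm h"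
    by metis
  define \<delta> where "\<delta> = Min (insert 1 (\<delta>' ` A))"
  have \<delta>: "\<delta> > 0" "\<And>i. i \<in> A \<Longrightarrow> \<delta> \<le> \<delta>' i" using \<delta>'(1) by (auto simp: \<delta>_def)
  have "\<exists>z. norm z \<le> e * t \<and> (\<forall>i\<in>A. G i (x + (t *\<^sub>R d + z)) = t * (d \<bullet> grad i))"
    if t: "0 < t" "t < \<delta> / M" for t
  proof -
    define Z where "Z w = (\<Sum>j\<in>A. w $ j *\<^sub>R l j)" for w :: "real ^ 'm"
    \<comment> \<open>A fixed point \<open>w\<close> of \<open>\<Phi>\<close> is a solution of the active equations, and \<open>\<Phi> w\<close> is minus the
      linearization error at the step \<open>t *\<^sub>R d + Z w\<close>.\<close>
    define \<Phi> where "\<Phi> w = (\<chi> i. if i \<in> A then w $ i - (G i (x + (t *\<^sub>R d + Z w)) - t * (d \<bullet> grad i)) else 0)" for w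
    have Z: "norm (Z w) \<le> e * t" if "norm w \<le> \<rho> * t" for w
    proof -
      have "norm (Z w) \<le> (\<Sum>j\<in>A. \<rho> * t * norm (l j))"
        unfolding Z_def
        using component_le_norm_cart[of w] that
        by (intro order_trans[OF norm_sum] sum_mono) (auto intro!: mult_right_mono intro: order_trans)
      also have "\<dots> = (C * \<rho>) * t" by (simp add: C_def sum_distrib_left sum_distrib_right mult_ac)
      also have "\<dots> \<le> e * t" using C\<rho> t by (intro mult_right_mono) auto
      finally show ?thesis .
    qed
    have Zgrad: "Z w \<bullet> grad i = w $ i" if "i \<in> A" for i w
      using that by (simp add: Z_def inner_sum_left dual if_distrib cong: if_cong)
    have "norm (\<Phi> w) \<le> \<rho> * t" if w: "norm w \<le> \<rho> * t" for w
    proof -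
      let ?h = "t *\<^sub>R d + Z w"
      have h: "norm ?h \<le> M * t"
        using norm_triangle_ineq[of "t *\<^sub>R d" "Z w"] Z[OF w] t by (simp add: M_def algebra_simps)
      have "M * t < \<delta>" using t M by (simp add: field_simps)
      have "\<bar>\<Phi> w $ i\<bar> \<le> \<eta> * (M * t)" for i
      proof (cases "i \<in> A")
        case True
        have "\<Phi> w $ i = - (G i (x + ?h) - ?h \<bullet> grad i)"
          using True by (simp add: \<Phi>_def Zgrad inner_add_left)
        then have "\<bar>\<Phi> w $ i\<bar> \<le> \<eta> * norm ?h"
          using \<delta>'(2)[OF True, of ?h] \<delta>(2)[OF True] h \<open>M * t < \<delta>\<close> by simp
        also have "\<dots> \<le> \<eta> * (M * t)" using h \<eta> by simp
        finally show ?thesis .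
      qed (use \<eta> M t in \<open>auto simp: \<Phi>_def\<close>)
      then have "norm (\<Phi> w) \<le> (\<Sum>i\<in>(UNIV::'m set). \<eta> * (M * t))"
        by (intro order_trans[OF norm_le_l1_cart] sum_mono)
      also have "\<dots> = \<rho> * t" using \<eta>(2) by (simp add: mult_ac)
      finally show ?thesis .
    qed
    moreover have "continuous_on (cball 0 (\<rho> * t)) \<Phi>"
    proof -
      have "continuous_on (cball 0 (\<rho> * t)) (\<lambda>w. \<Phi> w $ i)" for i
      proof (cases "i \<in> A")
        case True
        then show ?thesis unfolding \<Phi>_def Z_def
          by (auto intro!: continuous_intros continuous_on_compose2[OF cont[OF True]])
      qed (simp add: \<Phi>_def)
      then show ?thesis using continuous_on_vec_lambda[of "cball 0 (\<rho> * t)" "\<lambda>i w. \<Phi> w $ i"] by simp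
    qed
    ultimately obtain w where w: "norm w \<le> \<rho> * t" "\<Phi> w = w"
      using brouwer_ball[of "\<rho> * t" 0 \<Phi>] \<rho> t by auto
    have "G i (x + (t *\<^sub>R d + Z w)) = t * (d \<bullet> grad i)" if "i \<in> A" for i
      using arg_cong[OF w(2), of "\<lambda>v. v $ i"] that by (simp add: \<Phi>_def)
    with Z[OF w(1)] show ?thesis by blast
  qed
  moreover have "\<delta> / M > 0" using \<delta> M by simp
  ultimately show thesis using that by blast
qed

text \<open>A direction \<open>d\<close> admissible for the linearized active constraints is tangent to a curve of
  feasible points: the corrected steps of \<open>feasible_displacement\<close> satisfy the active constraints, and
  the inactive ones persist near \<open>x\<close>. Minimality along that curve gives \<open>d \<bullet> c \<ge> - e * norm c\<close> for
  every relative correction size \<open>e\<close>.\<close>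

lemma linear_minimizer_tangent_direction:
  fixes G :: "'m::finite \<Rightarrow> 'a::euclidean_space \<Rightarrow> real"
  assumes deriv: "\<And>i. (G i has_derivative (\<lambda>h. h \<bullet> grad i)) (at x)"
    and cont: "\<And>i. continuous_on UNIV (G i)"
    and dual: "\<And>i j. G i x = 0 \<Longrightarrow> l j \<bullet> grad i = (if i = j then 1 else 0)"
    and feas: "\<forall>i\<in>\<E>. G i x = 0" "\<forall>i\<in>\<I>. G i x \<ge> 0"
    and min: "\<And>y. \<forall>i\<in>\<E>. G i y = 0 \<Longrightarrow> \<forall>i\<in>\<I>. G i y \<ge> 0 \<Longrightarrow> (y - x) \<bullet> c \<ge> 0"
    and d: "\<And>i. i \<in> \<E> \<Longrightarrow> d \<bullet> grad i = 0" "\<And>i. i \<in> \<I> \<Longrightarrow> G i x = 0 \<Longrightarrow> d \<bullet> grad i \<ge> 0"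
  shows "d \<bullet> c \<ge> 0"
proof -
  have "\<forall>\<^sub>F y in nhds x. \<forall>i\<in>{i\<in>\<I>. G i x > 0}. G i y > 0"
  proof (intro eventually_ball_finite ballI)
    fix i assume "i \<in> {i\<in>\<I>. G i x > 0}"
    moreover have "(G i \<longlongrightarrow> G i x) (nhds x)"
      using cont[of i] by (metis UNIV_I continuous_on_eq_continuous_at isCont_def open_UNIV tendsto_at_iff_tendsto_nhds)
    ultimately show "\<forall>\<^sub>F y in nhds x. G i y > 0" by (auto dest: order_tendstoD)
  qed simp
  then obtain r where r: "r > 0" "\<And>y i. dist y x < r \<Longrightarrow> i \<in> \<I> \<Longrightarrow> G i x > 0 \<Longrightarrow> G i y > 0"
    unfolding eventually_nhds_metric by auto
  have bound: "0 \<le> d \<bullet> c + e * norm c" if e: "e > 0" for e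
  proof -
    obtain \<tau> where \<tau>: "\<tau> > 0" "\<And>t. 0 < t \<Longrightarrow> t < \<tau> \<Longrightarrow>
        \<exists>z. norm z \<le> e * t \<and> (\<forall>i\<in>{i. G i x = 0}. G i (x + (t *\<^sub>R d + z)) = t * (d \<bullet> grad i))"
      by (rule feasible_displacement[of "{i. G i x = 0}" G grad x l e d])
         (use deriv cont dual e in auto)
    have M: "norm d + e > 0" using e by (simp add: add_nonneg_pos)
    define q where "q = r / (norm d + e)"
    have "q > 0" using r(1) M by (simp add: q_def)
    define t where "t = min \<tau> q / 2"
    have t: "0 < t" "t < \<tau>" "t < r / (norm d + e)" using \<tau>(1) \<open>q > 0\<close> by (auto simp: t_def min_def simp flip: q_def)
    obtain z where z: "norm z \<le> e * t"
        "\<And>i. G i x = 0 \<Longrightarrow> G i (x + (t *\<^sub>R d + z)) = t * (d \<bullet> grad i)"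
      using \<tau>(2)[OF t(1,2)] by auto
    have "norm (t *\<^sub>R d + z) \<le> (norm d + e) * t"
      using norm_triangle_ineq[of "t *\<^sub>R d" z] z(1) t by (simp add: algebra_simps)
    also have "\<dots> < r" using t(3) M by (simp add: field_simps)
    finally have near: "dist (x + (t *\<^sub>R d + z)) x < r" by (simp add: dist_norm)
    have "0 \<le> (x + (t *\<^sub>R d + z) - x) \<bullet> c"
    proof (rule min; intro ballI)
      fix i assume "i \<in> \<E>"
      then show "G i (x + (t *\<^sub>R d + z)) = 0" using z(2) feas d(1) by simp
    next
      fix i assume i: "i \<in> \<I>"
      show "G i (x + (t *\<^sub>R d + z)) \<ge> 0"
      proof (cases "G i x = 0")
        case True
        then show ?thesis using z(2) d(2)[OF i] t by simp
      next
        case False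
        then show ?thesis using r(2)[OF near i] feas i by fastforce
      qed
    qed
    also have "\<dots> = t * (d \<bullet> c) + z \<bullet> c" by (simp add: inner_add_left)
    also have "z \<bullet> c \<le> e * t * norm c"
      using Cauchy_Schwarz_ineq2[of z c] mult_right_mono[OF z(1), of "norm c"] by simp
    finally have "0 \<le> t * (d \<bullet> c + e * norm c)" by (simp add: algebra_simps)
    then show ?thesis using t(1) by (simp add: zero_le_mult_iff)
  qed
  show ?thesis
  proof (rule field_le_epsilon)
    fix e :: real assume "e > 0"
    moreover have "norm c + 1 > 0" by (simp add: add_nonneg_pos)
    ultimately have "e / (norm c + 1) * norm c \<le> e" "e / (norm c + 1) > 0"
      by (auto simp: divide_simps)
    then show "0 \<le> d \<bullet> c + e" using bound[of "e / (norm c + 1)"] by linarith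
  qed
qed

text \<open>The multipliers are the derivatives \<open>l i \<bullet> c\<close> of the objective along the dual system. To first
  order \<open>l i\<close> changes no active constraint but the \<open>i\<close>th, which it increases; it is therefore
  admissible if that constraint is an active inequality, and both
  \<open>l i\<close> and \<open>- l i\<close> are admissible if the \<open>i\<close>th constraint is inactive. For the representation of
  \<open>c\<close>, subtract from an arbitrary \<open>d\<close> its components along the \<open>l j\<close> of the active constraints; what
  remains is orthogonal to the active gradients, hence to \<open>c\<close>.\<close>

lemma linear_minimizer_multipliers:
  fixes G :: "'m::finite \<Rightarrow> 'a::euclidean_space \<Rightarrow> real"
  assumes deriv: "\<And>i. (G i has_derivative (\<lambda>h. h \<bullet> grad i)) (at x)"
    and cont: "\<And>i. continuous_on UNIV (G i)"
    and dual: "\<And>i j. G i x = 0 \<Longrightarrow> l j \<bullet> grad i = (if i = j then 1 else 0)"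
    and feas: "\<forall>i\<in>\<E>. G i x = 0" "\<forall>i\<in>\<I>. G i x \<ge> 0"
    and min: "\<And>y. \<forall>i\<in>\<E>. G i y = 0 \<Longrightarrow> \<forall>i\<in>\<I>. G i y \<ge> 0 \<Longrightarrow> (y - x) \<bullet> c \<ge> 0"
    and disj: "\<E> \<inter> \<I> = {}"
  shows "c = (\<Sum>i\<in>UNIV. (l i \<bullet> c) *\<^sub>R grad i)"
    and "\<And>i. i \<in> \<I> \<Longrightarrow> l i \<bullet> c \<ge> 0"
    and "\<And>i. (l i \<bullet> c) * G i x = 0"
proof -
  note tangent = linear_minimizer_tangent_direction[OF deriv cont dual feas min]
  have orth: "d \<bullet> c = 0" if "\<And>i. G i x = 0 \<Longrightarrow> d \<bullet> grad i = 0" for d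
    using tangent[of d] tangent[of "- d"] that feas by fastforce
  have inactive: "l i \<bullet> c = 0" if "G i x \<noteq> 0" for i
    using that by (intro orth) (auto simp: dual)
  then show "(l i \<bullet> c) * G i x = 0" for i by (cases "G i x = 0") auto
  show "l i \<bullet> c \<ge> 0" if "i \<in> \<I>" for i
    using that feas disj by (intro tangent) (auto simp: dual)
  have "c \<bullet> d = (\<Sum>i\<in>UNIV. (l i \<bullet> c) *\<^sub>R grad i) \<bullet> d" for d
  proof -
    let ?A = "{i. G i x = 0}"
    have "(d - (\<Sum>j\<in>?A. (d \<bullet> grad j) *\<^sub>R l j)) \<bullet> c = 0"
      by (rule orth) (simp add: inner_diff_left inner_sum_left dual if_distrib cong: if_cong)
    then have "d \<bullet> c = (\<Sum>j\<in>?A. (d \<bullet> grad j) * (l j \<bullet> c))"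
      by (simp add: inner_diff_left inner_sum_left)
    also have "\<dots> = (\<Sum>j\<in>UNIV. (d \<bullet> grad j) * (l j \<bullet> c))"
      by (rule sum.mono_neutral_left) (auto simp: inactive)
    finally show ?thesis
      by (simp add: inner_sum_left inner_commute[of c d] inner_commute[of "grad _" d] mult.commute)
  qed
  then show "c = (\<Sum>i\<in>UNIV. (l i \<bullet> c) *\<^sub>R grad i)" using vector_eq_rdot by blast
qed


section \<open>Solutions are KKT points\<close>

text \<open>Only the first \<open>n\<close> entries of row \<open>i\<close> of \<open>L(x)\<close> are kept: the others are multiplied by \<open>0\<close> in
  \<open>\<lambda>\<^sub>i(x)\<close>, and by \<open>g\<^sub>j(x)\<close> in the product with the \<open>j\<close>th column of \<open>G(x)\<close>.\<close>

definition left_inverse_row :: "'n::finite mpoly ^ ('n + 'm::finite) ^ 'm \<Rightarrow> real ^ 'n \<Rightarrow> 'm \<Rightarrow> real ^ 'n" where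
  "left_inverse_row L x i = (\<chi> k. peval (L $ i $ Inl k) x)"

lemma sum_UNIV_Plus:
  fixes h :: "'a::finite + 'b::finite \<Rightarrow> 'c::comm_monoid_add"
  shows "(\<Sum>r\<in>UNIV. h r) = (\<Sum>k\<in>UNIV. h (Inl k)) + (\<Sum>k\<in>UNIV. h (Inr k))"
  by (subst UNIV_Plus_UNIV[symmetric], subst sum.Plus) auto

text \<open>Entry \<open>(i, j)\<close> of \<open>L(x) G(x) = I\<close> loses the contribution of its lower block when \<open>g\<^sub>j(x) = 0\<close>.
  Hence the rows of \<open>L(x)\<close> form a system dual to the active gradients.\<close>

lemma left_inverse_row_dual:
  fixes g :: "'n::finite mpoly ^ 'm::finite"
  assumes "L ** G_mat g = mat 1" and "peval (g $ j) x = 0"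
  shows "left_inverse_row L x i \<bullet> peval_vec (mgrad (g $ j)) x = (if j = i then 1 else 0)"
proof -
  have "(L ** G_mat g) $ i $ j = (if i = j then 1 else 0)" using assms(1) by (simp add: mat_def)
  then have "peval ((L ** G_mat g) $ i $ j) x = (if i = j then 1 else (0::real))" by simp
  moreover have "peval ((L ** G_mat g) $ i $ j) x =
      left_inverse_row L x i \<bullet> peval_vec (mgrad (g $ j)) x + peval (L $ i $ Inr j) x * peval (g $ j) x"
    by (simp add: matrix_matrix_mult_def peval_add peval_sum peval_mult sum_UNIV_Plus G_mat_def
        left_inverse_row_def inner_vec_def peval_vec_def if_distrib[of "\<lambda>p. peval p x"] 
        if_distrib[of "(*) _"] cong: if_cong)
  ultimately show ?thesis using assms(2) by auto
qed

lemma peval_multipliers: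
  fixes F :: "'n::finite mpoly ^ 'n"
  shows "peval (multipliers L F $ i) x = left_inverse_row L x i \<bullet> peval_vec F x"
  by (simp add: multipliers_def matrix_vector_mult_def peval_sum peval_mult sum_UNIV_Plus F_hat_def
      left_inverse_row_def inner_vec_def peval_vec_def)

text \<open>A solution \<open>x\<close> minimizes \<open>(y - x) \<bullet> F(x)\<close> over the constraint set, a problem with objective
  linear in \<open>y\<close>. With the rows of \<open>L(x)\<close> as dual system, its multipliers \<open>l i \<bullet> c\<close> are exactly the
  values \<open>\<lambda>\<^sub>i(x)\<close>.\<close>

lemma SOL_subset_KKT_set:
  fixes g :: "'n::finite mpoly ^ 'm::finite"
  assumes "L ** G_mat g = mat 1" and "\<E> \<inter> \<I> = {}"
  shows "SOL (constraint_set \<E> \<I> g) (peval_vec F) \<subseteq> KKT_set \<E> \<I> g L F"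
proof
  fix x assume x: "x \<in> SOL (constraint_set \<E> \<I> g) (peval_vec F)"
  have feas: "\<forall>i\<in>\<E>. peval (g $ i) x = 0" "\<forall>i\<in>\<I>. peval (g $ i) x \<ge> 0"
    and min: "\<And>y. \<forall>i\<in>\<E>. peval (g $ i) y = 0 \<Longrightarrow> \<forall>i\<in>\<I>. peval (g $ i) y \<ge> 0 \<Longrightarrow>
      (y - x) \<bullet> peval_vec F x \<ge> 0"
    using x by (auto simp: SOL_def constraint_set_def)
  note mult = linear_minimizer_multipliers[OF has_derivative_peval continuous_on_peval
      left_inverse_row_dual[OF assms(1)] feas min assms(2), folded peval_multipliers]
  show "x \<in> KKT_set \<E> \<I> g L F"
    unfolding KKT_set_def using mult feas by blast
qed

lemma KKT_set_subset_constraint_set: "KKT_set \<E> \<I> g L F \<subseteq> constraint_set \<E> \<I> g"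
  by (auto simp: KKT_set_def constraint_set_def)

lemma closed_KKT_set: "closed (KKT_set \<E> \<I> g L F)"
  unfolding KKT_set_def Ball_def
  by (intro closed_Collect_conj closed_Collect_all closed_Collect_imp open_Collect_const
      closed_Collect_eq closed_Collect_le
      continuous_intros continuous_on_peval continuous_on_peval_vec)

lemma closed_constraint_set: "closed (constraint_set \<E> \<I> g)"
  unfolding constraint_set_def Ball_def
  by (intro closed_Collect_conj closed_Collect_all closed_Collect_imp open_Collect_const
      closed_Collect_eq closed_Collect_le
      continuous_intros continuous_on_peval)


section \<open>Solvability of Step 1\<close>

lemma pos_def_coercive:
  fixes \<Theta> :: "real ^ 'k ^ 'k"
  assumes "pos_def \<Theta>"
  obtains c where "c > 0" "\<And>z. c * (norm z)\<^sup>2 \<le> z \<bullet> (\<Theta> *v z)"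
proof -
  have cont: "continuous_on S (\<lambda>z. z \<bullet> (\<Theta> *v z))" for S
    by (intro continuous_intros linear_continuous_on matrix_vector_mul_bounded_linear)
  obtain z0 :: "real ^ 'k" where z0: "z0 \<in> sphere 0 1" "\<And>z. z \<in> sphere 0 1 \<Longrightarrow> z0 \<bullet> (\<Theta> *v z0) \<le> z \<bullet> (\<Theta> *v z)"
    using continuous_attains_inf[OF compact_sphere _ cont, of "0 :: real ^ 'k" 1] by auto
  show thesis
  proof
    show "z0 \<bullet> (\<Theta> *v z0) > 0" using z0(1) assms unfolding pos_def_def by (metis dist_0_norm mem_sphere norm_zero zero_neq_one)
    show "z0 \<bullet> (\<Theta> *v z0) * (norm z)\<^sup>2 \<le> z \<bullet> (\<Theta> *v z)" for z
    proof (cases "z = 0")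
      case False
      let ?y = "z /\<^sub>R norm z"
      have "z0 \<bullet> (\<Theta> *v z0) * (norm z)\<^sup>2 \<le> (?y \<bullet> (\<Theta> *v ?y)) * (norm z)\<^sup>2"
        using False by (intro mult_right_mono z0(2)) auto
      also have "\<dots> = z \<bullet> (\<Theta> *v z)"
        using False by (simp add: matrix_vector_mult_scaleR power2_eq_square field_simps)
      finally show ?thesis .
    qed simp
  qed
qed

lemma continuous_on_hom1: "continuous_on S (hom1 :: real ^ 'n::finite \<Rightarrow> _)"
proof -
  have "continuous_on S (\<lambda>x :: real ^ 'n. case i of None \<Rightarrow> 1 | Some j \<Rightarrow> x $ j)" for i
    by (cases i) (auto intro!: continuous_intros)
  then show ?thesis unfolding hom1_def[abs_def] by (intro continuous_on_vec_lambda)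
qed

lemma norm_le_norm_hom1: "norm x \<le> norm (hom1 (x :: real ^ 'n::finite))"
proof -
  have "(\<Sum>j\<in>UNIV. (x $ j)\<^sup>2) = (\<Sum>i\<in>range Some. (hom1 x $ i)\<^sup>2)"
    by (subst sum.reindex) (auto simp: hom1_def)
  also have "\<dots> \<le> (\<Sum>i\<in>UNIV. (hom1 x $ i)\<^sup>2)" by (rule sum_mono2) auto
  finally show ?thesis by (simp add: norm_vec_def L2_set_def)
qed

text \<open>The objective dominates a multiple of \<open>(norm x)\<^sup>2\<close>, so its sublevel sets are bounded and those
  within a closed feasible set are compact.\<close>

lemma step1_minimizer_exists:
  fixes S :: "(real ^ 'n::finite) set"
  assumes "pos_def \<Theta>" "closed S" "S \<noteq> {}"
  shows "\<exists>u. is_arg_min (\<lambda>x. hom1 x \<bullet> (\<Theta> *v hom1 x)) (\<lambda>x. x \<in> S) u"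
proof -
  let ?q = "\<lambda>x :: real ^ 'n. hom1 x \<bullet> (\<Theta> *v hom1 x)"
  obtain c where c: "c > 0" "\<And>z. c * (norm z)\<^sup>2 \<le> z \<bullet> (\<Theta> *v z)"
    using pos_def_coercive[OF assms(1)] by blast
  obtain x0 where x0: "x0 \<in> S" using assms(3) by blast
  have cont: "continuous_on A ?q" for A
    by (intro continuous_intros continuous_on_hom1 
        bounded_linear.continuous_on[OF matrix_vector_mul_bounded_linear])
  let ?C = "S \<inter> {x. ?q x \<le> ?q x0}"
  have "norm x \<le> sqrt (?q x0 / c)" if "x \<in> ?C" for x
  proof (rule real_le_rsqrt)
    have "c * (norm x)\<^sup>2 \<le> c * (norm (hom1 x))\<^sup>2"
      using c(1) norm_le_norm_hom1[of x] by (simp add: power_mono)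
    also have "\<dots> \<le> ?q x0" using c(2)[of "hom1 x"] that by simp
    finally show "(norm x)\<^sup>2 \<le> ?q x0 / c" using c(1) by (simp add: field_simps)
  qed
  then have "bounded ?C" unfolding bounded_iff by blast
  moreover have "closed ?C" by (intro closed_Int assms closed_Collect_le cont continuous_on_const)
  ultimately obtain u where "u \<in> ?C" "\<And>x. x \<in> ?C \<Longrightarrow> ?q u \<le> ?q x"
    using continuous_attains_inf[OF _ _ cont, of ?C] x0 by (auto simp: compact_eq_bounded_closed)
  then have "is_arg_min ?q (\<lambda>x. x \<in> S) u"
    unfolding is_arg_min_def by force
  then show ?thesis ..
qed

lemma closed_step1_feasible:
  assumes "closed K" "continuous_on UNIV f"
  shows "closed (step1_feasible K f V)"
proof -
  have "closed {x. 0 \<le> (v - x) \<bullet> f x}" for v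
    by (intro closed_Collect_le continuous_intros assms(2))
  moreover have "step1_feasible K f V = K \<inter> (\<Inter>v\<in>V. {x. 0 \<le> (v - x) \<bullet> f x})"
    by (auto simp: step1_feasible_def)
  ultimately show ?thesis using assms(1) by auto
qed


section \<open>The invariant of a run\<close>

text \<open>Every completed iteration has removed at least one of the spurious points, those of
  \<open>K - SOL X f\<close>, from the feasible set of Step 1. The finiteness premise is part of the predicate so
  that the remaining parts of the invariant are also available when there are infinitely many
  spurious points.\<close>

definition counter_bounded where
  "counter_bounded K X f k V \<longleftrightarrow> finite (K - SOL X f) \<longrightarrow>
     k \<le> card (K - SOL X f - step1_feasible K f V) + 1"

fun run_invariant where
  "run_invariant K X f (Step1 k V) \<longleftrightarrow> V \<subseteq> X \<and> counter_bounded K X f k V"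
| "run_invariant K X f (Step2 k V u) \<longleftrightarrow> V \<subseteq> X \<and> counter_bounded K X f k V \<and> u \<in> step1_feasible K f V"
| "run_invariant K X f (Step3 k V u \<epsilon> T) \<longleftrightarrow> V \<subseteq> X \<and> counter_bounded K X f k V \<and>
     u \<in> step1_feasible K f V \<and> T \<noteq> {} \<and> (\<forall>y\<in>T. step2_minimizer X f u y \<and> \<epsilon> = (y - u) \<bullet> f u)"
| "run_invariant K X f (No_Solution k) \<longleftrightarrow>
     SOL X f = {} \<and> (finite (K - SOL X f) \<longrightarrow> k \<le> card (K - SOL X f) + 1)"
| "run_invariant K X f (Solution k u) \<longleftrightarrow>
     u \<in> SOL X f \<and> (finite (K - SOL X f) \<longrightarrow> k \<le> card (K - SOL X f) + 1)"

lemma counter_boundedD: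
  assumes "counter_bounded K X f k V" "finite (K - SOL X f)"
  shows "k \<le> card (K - SOL X f) + 1"
proof -
  have "card (K - SOL X f - step1_feasible K f V) \<le> card (K - SOL X f)"
    by (rule card_mono) (use assms(2) in auto)
  then show ?thesis using assms by (simp add: counter_bounded_def)
qed

text \<open>The cuts are satisfied by every solution because they are generated by points of \<open>X\<close>; this is why
  infeasibility in Step 1 refutes solvability.\<close>

lemma SOL_subset_step1_feasible:
  assumes "SOL X f \<subseteq> K" "V \<subseteq> X"
  shows "SOL X f \<subseteq> step1_feasible K f V"
  using assms by (auto simp: SOL_def step1_feasible_def)

lemma step2_minimizer_iff:
  "step2_minimizer X f u y \<longleftrightarrow> y \<in> X \<and> (\<forall>z\<in>X. (y - u) \<bullet> f u \<le> (z - u) \<bullet> f u)"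
  by (auto simp: step2_minimizer_def is_arg_min_def not_less)

text \<open>The iterate \<open>u\<close> is itself the spurious point removed: testing \<open>y = u\<close> shows \<open>\<epsilon> \<le> 0\<close>, so
  \<open>\<epsilon> \<noteq> 0\<close> means that each \<open>y \<in> T\<close> violates the variational inequality at \<open>u\<close>, and the cut
  generated by \<open>y\<close> excludes \<open>u\<close>.\<close>

lemma counter_bounded_refine:
  assumes KX: "K \<subseteq> X" and inv: "run_invariant K X f (Step3 k V u \<epsilon> T)" and "\<epsilon> \<noteq> 0"
  shows "counter_bounded K X f (k + 1) (V \<union> T)"
  unfolding counter_bounded_def
proof
  assume fin: "finite (K - SOL X f)"
  let ?R = "\<lambda>V. K - SOL X f - step1_feasible K f V"
  obtain y where y: "y \<in> T" "step2_minimizer X f u y" "\<epsilon> = (y - u) \<bullet> f u" using inv by auto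
  have u: "u \<in> K" "u \<in> X" "u \<in> step1_feasible K f V" using inv KX by (auto simp: step1_feasible_def)
  have neg: "(y - u) \<bullet> f u < 0"
    using y u(2) \<open>\<epsilon> \<noteq> 0\<close> by (force simp: step2_minimizer_iff)
  have "u \<in> ?R (V \<union> T) - ?R V"
    using u y(1,2) neg by (force simp: SOL_def step1_feasible_def step2_minimizer_iff)
  moreover have "?R V \<subseteq> ?R (V \<union> T)" by (auto simp: step1_feasible_def)
  ultimately have "card (?R V) < card (?R (V \<union> T))"
    using fin by (intro psubset_card_mono) auto
  then show "k + 1 \<le> card (?R (V \<union> T)) + 1"
    using inv fin by (simp add: counter_bounded_def)
qed

lemma run_invariant_step:
  assumes KX: "K \<subseteq> X" and SK: "SOL X f \<subseteq> K"
    and "alg_step \<Theta> K X f s s'" and "run_invariant K X f s"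
  shows "run_invariant K X f s'"
  using assms(3,4)
proof cases
  case (infeasible V k)
  then show ?thesis
    using assms(4) SOL_subset_step1_feasible[OF SK, of V] counter_boundedD[of K X f k V] by auto
next
  case (minimize V u k)
  then show ?thesis using assms(4) by (auto simp: is_arg_min_def)
next
  case (check T u \<epsilon> k V)
  then show ?thesis using assms(4) by auto
next
  case (accept \<epsilon> k V u T)
  then obtain y where y: "step2_minimizer X f u y" "(y - u) \<bullet> f u = 0" using assms(4) by auto
  have "u \<in> X" using accept assms(4) KX by (auto simp: step1_feasible_def)
  with y have "u \<in> SOL X f" by (auto simp: SOL_def step2_minimizer_iff)
  then show ?thesis using accept assms(4) counter_boundedD[of K X f k V] by auto
next
  case (refine \<epsilon> k V u T)
  then have "V \<union> T \<subseteq> X" using assms(4) by (auto simp: step2_minimizer_iff)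
  with refine counter_bounded_refine[OF KX, of f k V u \<epsilon> T] assms(4) show ?thesis by simp
qed

lemma run_invariant_run:
  assumes KX: "K \<subseteq> X" and SK: "SOL X f \<subseteq> K" and run: "alg_run \<Theta> K X f \<sigma>"
  shows "run_invariant K X f (\<sigma> i)"
proof (induction i)
  case 0
  then show ?case using run by (simp add: alg_run_def counter_bounded_def)
next
  case (Suc i)
  then show ?case using run run_invariant_step[OF KX SK] unfolding alg_run_def by metis
qed


section \<open>Termination\<close>

fun final where
  "final (No_Solution k) = True"
| "final (Solution k u) = True"
| "final _ = False"

text \<open>An iteration consists of three steps, and along the non-final states this number increases by
  one in each of them; its value \<open>0\<close> at final states is arbitrary.\<close>

fun progress where
  "progress (Step1 k V) = 3 * k"
| "progress (Step2 k V u) = 3 * k + 1"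
| "progress (Step3 k V u \<epsilon> T) = 3 * k + (2::nat)"
| "progress _ = 0"

lemma alg_step_exists:
  assumes "pos_def \<Theta>" "closed K" "continuous_on UNIV f" and "\<not> final s"
    and step2: "\<And>k V u. s = Step2 k V u \<Longrightarrow> \<exists>y. step2_minimizer X f u y"
  shows "\<exists>s'. alg_step \<Theta> K X f s s'"
proof (cases s)
  case (Step1 k V)
  show ?thesis
  proof (cases "step1_feasible K f V = {}")
    case True
    then show ?thesis using Step1 alg_step.infeasible by blast
  next
    case False
    then show ?thesis
      using Step1 alg_step.minimize
        step1_minimizer_exists[OF assms(1) closed_step1_feasible[OF assms(2,3)] False] by blast
  qed
next
  case (Step2 k V u)
  then obtain y where "step2_minimizer X f u y" using step2 by blast
  then show ?thesis
    using Step2 alg_step.check[of "{y}" X f u "(y - u) \<bullet> f u"] by blast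
next
  case (Step3 k V u \<epsilon> T)
  show ?thesis
  proof (cases "\<epsilon> = 0")
    case True
    show ?thesis unfolding Step3 by (rule exI, rule alg_step.accept[OF True])
  next
    case False
    show ?thesis unfolding Step3 by (rule exI, rule alg_step.refine[OF False])
  qed
qed (use assms(4) in auto)

lemma progress_step:
  assumes "alg_step \<Theta> K X f s s'" "\<not> final s'"
  shows "progress s' = progress s + 1"
  using assms by cases auto

text \<open>A run that never reaches a final state is never stuck, so its iteration counter is unbounded,
  contrary to the bound by the number of spurious points.\<close>

lemma run_reaches_final_state:
  assumes "pos_def \<Theta>" "closed K" "continuous_on UNIV f"
    and KX: "K \<subseteq> X" and SK: "SOL X f \<subseteq> K" and fin: "finite (K - SOL X f)"
    and run: "alg_run \<Theta> K X f \<sigma>" and step2: "step2_solvable X f \<sigma>"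
  obtains i where "final (\<sigma> i)"
proof (rule ccontr)
  assume "\<not> thesis"
  then have nf: "\<not> final (\<sigma> i)" for i using that by blast
  have step: "alg_step \<Theta> K X f (\<sigma> i) (\<sigma> (Suc i))" for i
    using alg_step_exists[OF assms(1-3) nf, of i X] run step2
    unfolding alg_run_def step2_solvable_def by metis
  have "progress (\<sigma> i) = i + 3" for i
  proof (induction i)
    case 0
    then show ?case using run by (simp add: alg_run_def)
  next
    case (Suc i)
    then show ?case using progress_step[OF step nf] by simp
  qed
  moreover have "progress (\<sigma> i) < 3 * (card (K - SOL X f) + 2)" for i
    using run_invariant_run[OF KX SK run, of i] counter_boundedD[OF _ fin] 
    by (cases "\<sigma> i") force+
  ultimately have "i + 3 < 3 * (card (K - SOL X f) + 2)" for i by metis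
  from this[of "3 * (card (K - SOL X f) + 2)"] show False by simp
qed


section \<open>Accumulation points of an infinite run\<close>

text \<open>A predicate that holds in Step 3 of iteration \<open>k\<close> with new cuts \<open>T\<close> and is preserved by all later
  steps. It also records that the iteration counter never falls below \<open>k\<close>, which allows states to be
  ordered by their counters.\<close>

fun retains where
  "retains k T (Step1 l V) \<longleftrightarrow> k < l \<and> T \<subseteq> V"
| "retains k T (Step2 l V u) \<longleftrightarrow> k < l \<and> T \<subseteq> V"
| "retains k T (Step3 l V u \<epsilon> S) \<longleftrightarrow> (l = k \<and> S = T) \<or> (k < l \<and> T \<subseteq> V)"
| "retains k T _ \<longleftrightarrow> True"

lemma retains_step:
  assumes "alg_step \<Theta> K X f s s'" "retains k T s"
  shows "retains k T s'"
  using assms by cases auto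

lemma retains_run:
  assumes run: "alg_run \<Theta> K X f \<sigma>" and "\<sigma> i = Step3 k V u \<epsilon> T" and "i \<le> j"
  shows "retains k T (\<sigma> j)"
  using assms(3)
proof (induction j rule: dec_induct)
  case base
  then show ?case using assms(2) by simp
next
  case (step j)
  then show ?case using run retains_step unfolding alg_run_def by metis
qed

lemma cuts_persist:
  assumes run: "alg_run \<Theta> K X f \<sigma>" and i: "\<sigma> i = Step3 k V u \<epsilon> T"
    and j: "\<sigma> j = Step3 l W w \<delta> S" and "k < l"
  shows "T \<subseteq> W"
proof (cases "i \<le> j")
  case True
  then show ?thesis using retains_run[OF run i True] j \<open>k < l\<close> by auto
next
  case False
  then show ?thesis using retains_run[OF run j, of i] i \<open>k < l\<close> by auto
qed

lemma gap_eq_minimum: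
  assumes "step2_minimizer X f u y"
  shows "gap X f u = ereal ((y - u) \<bullet> f u)"
  unfolding gap_def
proof (rule antisym)
  show "(INF z\<in>X. ereal ((z - u) \<bullet> f u)) \<le> ereal ((y - u) \<bullet> f u)"
    by (rule INF_lower) (use assms in \<open>simp add: step2_minimizer_iff\<close>)
  show "ereal ((y - u) \<bullet> f u) \<le> (INF z\<in>X. ereal ((z - u) \<bullet> f u))"
    by (rule INF_greatest) (use assms in \<open>simp add: step2_minimizer_iff\<close>)
qed

lemma SOL_iff_gap: "x \<in> SOL X f \<longleftrightarrow> x \<in> X \<and> gap X f x \<ge> 0"
  by (auto simp: SOL_def gap_def le_INF_iff zero_ereal_def)

text \<open>The argument for the limit. Letting \<open>l\<close> tend to infinity in the cuts shows that \<open>u'\<close> satisfies the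
  cut of every \<open>v k\<close>. But \<open>v k\<close> realizes the gap at \<open>u k\<close>, and since the \<open>v k\<close> are bounded, the cut
  values at \<open>u k\<close> and at \<open>u'\<close> differ by a null sequence, uniformly in \<open>v k\<close>. So the gap at \<open>u k\<close> is
  bounded below by a null sequence, and continuity of the gap transfers this to \<open>u'\<close>.\<close>

lemma limit_of_cut_sequence_in_SOL:
  fixes f :: "real ^ 'n::finite \<Rightarrow> real ^ 'n"
  assumes "closed X" and cont: "continuous_on UNIV f"
    and u: "\<And>k. u k \<in> X" "u \<longlonglongrightarrow> u'"
    and v: "\<And>k. step2_minimizer X f (u k) (v k)" "bounded (range v)"
    and cuts: "\<And>k l. k < l \<Longrightarrow> (v k - u l) \<bullet> f (u l) \<ge> 0"
    and gap: "isCont (gap X f) u'"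
  shows "u' \<in> SOL X f"
  unfolding SOL_iff_gap
proof
  show "u' \<in> X" using closed_sequentially[OF assms(1)] u by blast
  have fu: "(\<lambda>k. f (u k)) \<longlonglongrightarrow> f u'"
    using continuous_on_tendsto_compose[OF cont u(2)] by simp
  obtain B where B: "\<And>k. norm (v k) \<le> B" using v(2) by (auto simp: bounded_iff)
  have cut': "(v k - u') \<bullet> f u' \<ge> 0" for k
  proof (rule tendsto_lowerbound)
    show "(\<lambda>l. (v k - u l) \<bullet> f (u l)) \<longlonglongrightarrow> (v k - u') \<bullet> f u'"
      by (intro tendsto_intros u(2) fu)
    show "\<forall>\<^sub>F l in sequentially. 0 \<le> (v k - u l) \<bullet> f (u l)"
      using eventually_gt_at_top[of k] by eventually_elim (rule cuts)
  qed simp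
  define b where "b k = - (B * norm (f (u k) - f u')) - (u k \<bullet> f (u k) - u' \<bullet> f u')" for k
  have "b \<longlonglongrightarrow> - (B * norm (f u' - f u')) - (u' \<bullet> f u' - u' \<bullet> f u')"
    unfolding b_def by (intro tendsto_intros fu u(2))
  then have "(\<lambda>k. ereal (b k)) \<longlonglongrightarrow> 0" by (simp add: zero_ereal_def)
  moreover have "(\<lambda>k. gap X f (u k)) \<longlonglongrightarrow> gap X f u'"
    by (rule isCont_tendsto_compose[OF gap u(2)])
  moreover have "ereal (b k) \<le> gap X f (u k)" for k
  proof -
    have "\<bar>v k \<bullet> (f (u k) - f u')\<bar> \<le> B * norm (f (u k) - f u')"
      using Cauchy_Schwarz_ineq2[of "v k" "f (u k) - f u'"]
        mult_right_mono[OF B[of k], of "norm (f (u k) - f u')"] by simp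
    then have "b k \<le> (v k - u k) \<bullet> f (u k)"
      using cut'[of k] by (simp add: b_def inner_diff_left inner_diff_right)
    then show ?thesis by (simp add: gap_eq_minimum[OF v(1)])
  qed
  ultimately show "0 \<le> gap X f u'" by (meson LIMSEQ_le)
qed

lemma accumulation_point_in_SOL:
  fixes f :: "real ^ 'n::finite \<Rightarrow> real ^ 'n"
  assumes "closed X" and cont: "continuous_on UNIV f"
    and KX: "K \<subseteq> X" and SK: "SOL X f \<subseteq> K" and run: "alg_run \<Theta> K X f \<sigma>"
    and it: "iterates \<sigma> u T" and acc: "accumulation_point u u'" and gap: "isCont (gap X f) u'"
    and k0: "k0 \<ge> 1" "bounded (\<Union>k\<in>{k0..}. T k)"
  shows "u' \<in> SOL X f"
proof -
  obtain ix V \<epsilon> where ix: "\<And>k. k \<ge> 1 \<Longrightarrow> \<sigma> (ix k) = Step3 k (V k) (u k) (\<epsilon> k) (T k)"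
    using it unfolding iterates_def by metis
  have inv: "run_invariant K X f (Step3 k (V k) (u k) (\<epsilon> k) (T k))" if "k \<ge> 1" for k
    using run_invariant_run[OF KX SK run, of "ix k"] ix[OF that] by simp
  obtain r where r: "strict_mono r" "(u \<circ> r) \<longlonglongrightarrow> u'" using acc unfolding accumulation_point_def by blast
  \<comment> \<open>Shifting the subsequence by \<open>k0\<close> avoids the meaningless index \<open>0\<close> and the indices at which
    \<open>T\<close> is not known to be bounded.\<close>
  define p where "p n = r (n + k0)" for n
  have p: "strict_mono p" "p n \<ge> k0" for n
    using r(1) seq_suble[OF r(1), of "n + k0"] by (auto simp: p_def strict_mono_def)
  have p1: "p n \<ge> 1" for n using p(2)[of n] k0(1) by linarith
  define v where "v n = (SOME y. y \<in> T (p n))" for n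
  have v: "v n \<in> T (p n)" for n
    using inv[OF p1[of n]] by (auto simp: v_def some_in_eq)
  show ?thesis
  proof (rule limit_of_cut_sequence_in_SOL[where u = "u \<circ> p" and v = v])
    show "(u \<circ> p) n \<in> X" for n
      using inv[OF p1[of n]] KX by (auto simp: step1_feasible_def)
    show "(u \<circ> p) \<longlonglongrightarrow> u'"
      using LIMSEQ_ignore_initial_segment[OF r(2), of k0] by (simp add: p_def comp_def)
    show "step2_minimizer X f ((u \<circ> p) n) (v n)" for n
      using inv[OF p1[of n]] v by auto
    show "bounded (range v)"
      by (rule bounded_subset[OF k0(2)]) (use v p(2) in blast)
    show "0 \<le> (v m - (u \<circ> p) n) \<bullet> f ((u \<circ> p) n)" if "m < n" for m n
    proof -
      have "p m < p n" using p(1) that by (simp add: strict_mono_def)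
      then have "T (p m) \<subseteq> V (p n)" using cuts_persist[OF run ix[OF p1] ix[OF p1]] by blast
      then show ?thesis using inv[OF p1[of n]] v[of m] by (auto simp: step1_feasible_def)
    qed
  qed (use assms in auto)
qed

section \<open>Correctness of the algorithm\<close>

theorem theorem3p4:
  fixes \<E> \<I> :: "'m::finite set"
    and F :: "'n::finite mpoly ^ 'n"
    and g :: "'n mpoly ^ 'm"
    and L :: "'n mpoly ^ ('n + 'm) ^ 'm"
    and X K :: "(real ^ 'n) set"
    and f :: "real ^ 'n \<Rightarrow> real ^ 'n"
  assumes "\<E> \<inter> \<I> = {}" and "\<E> \<union> \<I> = UNIV"
    and "nonsingular_tuple g"
    and "L ** G_mat g = mat 1"
    and f: "f = peval_vec F"
    and X: "X = constraint_set \<E> \<I> g"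
    and K: "K = KKT_set \<E> \<I> g L F"
    and "X \<noteq> {}"
  shows "generic_pos_def (\<lambda>\<Theta>. \<forall>\<sigma>. alg_run \<Theta> K X f \<sigma> \<and> step2_solvable X f \<sigma> \<longrightarrow>
    (SOL X f = {} \<and> finite (K - SOL X f) \<longrightarrow>
       (\<exists>i k. \<sigma> i = No_Solution k \<and> k \<le> card (K - SOL X f) + 1)) \<and>
    (SOL X f \<noteq> {} \<and> finite (K - SOL X f) \<longrightarrow>
       (\<exists>i k u. \<sigma> i = Solution k u \<and> u \<in> SOL X f \<and> k \<le> card (K - SOL X f) + 1)) \<and>
    (infinite (K - SOL X f) \<and> \<not> terminates \<sigma> \<longrightarrow>
       (\<forall>u T u'. iterates \<sigma> u T \<and> accumulation_point u u' \<and> isCont (gap X f) u' \<and>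
          (\<exists>k0\<ge>1. bounded (\<Union>k\<in>{k0..}. T k)) \<longrightarrow> u' \<in> SOL X f)))"
  unfolding generic_pos_def_def
proof (intro AE_I2 impI allI)
  fix A :: "real ^ ('n option) ^ ('n option)" and \<sigma>
  assume pd: "pos_def (sym_part A)" and "alg_run (sym_part A) K X f \<sigma> \<and> step2_solvable X f \<sigma>"
  then have run: "alg_run (sym_part A) K X f \<sigma>" and step2: "step2_solvable X f \<sigma>" by auto
  have SK: "SOL X f \<subseteq> K"
    unfolding f X K using assms(4,1) by (rule SOL_subset_KKT_set)
  have KX: "K \<subseteq> X" unfolding X K by (rule KKT_set_subset_constraint_set)
  have cont: "continuous_on UNIV f" unfolding f by (rule continuous_on_peval_vec)
  have closed: "closed K" "closed X"
    unfolding K X by (rule closed_KKT_set closed_constraint_set)+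
  note inv = run_invariant_run[OF KX SK run]
  note reach = run_reaches_final_state[OF pd closed(1) cont KX SK _ run step2]
  show "(SOL X f = {} \<and> finite (K - SOL X f) \<longrightarrow>
       (\<exists>i k. \<sigma> i = No_Solution k \<and> k \<le> card (K - SOL X f) + 1)) \<and>
    (SOL X f \<noteq> {} \<and> finite (K - SOL X f) \<longrightarrow>
       (\<exists>i k u. \<sigma> i = Solution k u \<and> u \<in> SOL X f \<and> k \<le> card (K - SOL X f) + 1)) \<and>
    (infinite (K - SOL X f) \<and> \<not> terminates \<sigma> \<longrightarrow>
       (\<forall>u T u'. iterates \<sigma> u T \<and> accumulation_point u u' \<and> isCont (gap X f) u' \<and>
          (\<exists>k0\<ge>1. bounded (\<Union>k\<in>{k0..}. T k)) \<longrightarrow> u' \<in> SOL X f))"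
  proof (intro conjI impI)
    assume none: "SOL X f = {} \<and> finite (K - SOL X f)"
    then obtain i where i: "final (\<sigma> i)" using reach by blast
    show "\<exists>i k. \<sigma> i = No_Solution k \<and> k \<le> card (K - SOL X f) + 1"
    proof (cases "\<sigma> i")
      case (No_Solution k)
      then show ?thesis using inv[of i] none by auto
    next
      case (Solution k u)
      then show ?thesis using inv[of i] none by auto
    qed (use i in auto)
  next
    assume some: "SOL X f \<noteq> {} \<and> finite (K - SOL X f)"
    then obtain i where i: "final (\<sigma> i)" using reach by blast
    show "\<exists>i k u. \<sigma> i = Solution k u \<and> u \<in> SOL X f \<and> k \<le> card (K - SOL X f) + 1"
    proof (cases "\<sigma> i")
      case (No_Solution k)
      then show ?thesis using inv[of i] some by auto
    next
      case (Solution k u)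
      then have "\<sigma> i = Solution k u \<and> u \<in> SOL X f \<and> k \<le> card (K - SOL X f) + 1"
        using inv[of i] some by simp
      then show ?thesis by blast
    qed (use i in auto)
  next
    show "\<forall>u T u'. iterates \<sigma> u T \<and> accumulation_point u u' \<and> isCont (gap X f) u' \<and>
        (\<exists>k0\<ge>1. bounded (\<Union>k\<in>{k0..}. T k)) \<longrightarrow> u' \<in> SOL X f"
      using accumulation_point_in_SOL[OF closed(2) cont KX SK run] by blast
  qed
qed

end
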